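(* Let $\tilde{h}_{\mathrm{a}}\colon \tilde{\mathcal{R}}_{\mathbf{m}}\to\mathbb{R}$ be a function on the normalized realizable set, and define $h_{\mathrm{a}}\colon\mathcal{R}_{\mathbf{m}}\to\mathbb{R}$ on the realizable set by $$h_{\mathrm{a}}(\mathbf{w}) = w_0\,\tilde{h}_{\mathrm{a}}(\tilde{\mathbf{w}}/w_0) + w_0\log w_0,\qquad \mathbf{w}=[w_0,\tilde{\mathbf{w}}^T]^T\in\mathcal{R}_{\mathbf{m}}.$$ If $\tilde{h}_{\mathrm{a}}$ is convex and twice differentiable, then $h_{\mathrm{a}}$ is convex and twice differentiable. If $\tilde{h}_{\mathrm{a}}$ is strictly convex and twice differentiable, then $h_{\mathrm{a}}$ is strictly convex and twice differentiable.
   Context: Let $V\subseteq\mathbb{R}^d$ be the (measurable) velocity domain, and write $\langle g\rangle:=\int_V g(v)\,dv$ (componentwise for vector-valued $g$). Let $n\ge 2$ and let $\mathbf{m}=[m_0,m_1,\dots,m_{n-1}]^T\colon V\to\mathbb{R}^n$ be a vector of linearly independent real-valued test functions with $m_0\equiv 1$ (for example, a polynomial basis such as the Legendre polynomials on $V=[-1,1]$). The realizable set (for the Maxwell-Boltzmann entropy) is $$\mathcal{R}_{\mathbf{m}}:=\{\mathbf{w}\in\mathbb{R}^n : \mathbf{w}=\langle \mathbf{m} g\rangle \text{ for some measurable } g\ge 0 \text{ on } V,\ g \text{ not a.e. zero, with } \langle|\mathbf{m} g|\rangle<\infty\}.$$ For $\mathbf{w}\in\mathcal{R}_{\mathbf{m}}$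 write $\mathbf{w}=[w_0,\tilde{\mathbf{w}}^T]^T$ with $w_0\in\mathbb{R}$ the zero-th moment and $\tilde{\mathbf{w}}\in\mathbb{R}^{n-1}$; then $w_0>0$. The normalized realizable set is $$\tilde{\mathcal{R}}_{\mathbf{m}}:=\{\tilde{\boldsymbol{\omega}}\in\mathbb{R}^{n-1} : [1,\tilde{\boldsymbol{\omega}}^T]^T\in\mathcal{R}_{\mathbf{m}}\}.$$ $\mathcal{R}_{\mathbf{m}}$ is a convex cone, so $\tilde{\mathbf{w}}/w_0\in\tilde{\mathcal{R}}_{\mathbf{m}}$ for every $\mathbf{w}\in\mathcal{R}_{\mathbf{m}}$, and $\tilde{\mathcal{R}}_{\mathbf{m}}$ is convex. Standing assumption: $\mathcal{R}_{\mathbf{m}}$ is open in $\mathbb{R}^n$ (hence $\tilde{\mathcal{R}}_{\mathbf{m}}$ is open in $\mathbb{R}^{n-1}$), so that derivatives make sense. *)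

theory Defs
  imports "HOL-Analysis.Analysis"
begin

(* The moment space R^n, n >= 2, is rendered as real \<times> real^'k with n = CARD('k) + 1:
   the first component is the zero-th moment, the second one the remaining n - 1 moments. *)

definition linearly_independent_on ::
    "'v set \<Rightarrow> ('v \<Rightarrow> real \<times> (real ^ 'k)) \<Rightarrow> bool" where
  "linearly_independent_on V m \<longleftrightarrow>
     (\<forall>(a :: real) (b :: real ^ 'k).
        (\<forall>v\<in>V. a * fst (m v) + (\<Sum>i\<in>UNIV. b $ i * snd (m v) $ i) = 0) \<longrightarrow> a = 0 \<and> b = 0)"

(* Bochner integrability of the vector-valued map v \<mapsto> g v *\<^sub>R m v includes its measurability and
   amounts to absolute integrability of each component. *)
definition realizable_set ::
    "'v::euclidean_space set \<Rightarrow> ('v \<Rightarrow> real \<times> (real ^ 'k)) \<Rightarrow> (real \<times> (real ^ 'k)) set" where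
  "realizable_set V m =
     {w. \<exists>g :: 'v \<Rightarrow> real.
           g \<in> borel_measurable (lebesgue_on V) \<and>
           (\<forall>v\<in>V. 0 \<le> g v) \<and>
           \<not> (AE v in lebesgue_on V. g v = 0) \<and>
           integrable (lebesgue_on V) (\<lambda>v. g v *\<^sub>R m v) \<and>
           w = (\<integral>v. g v *\<^sub>R m v \<partial>lebesgue_on V)}"

definition normalized_realizable_set ::
    "'v::euclidean_space set \<Rightarrow> ('v \<Rightarrow> real \<times> (real ^ 'k)) \<Rightarrow> (real ^ 'k) set" where
  "normalized_realizable_set V m = {\<omega>. (1, \<omega>) \<in> realizable_set V m}"

definition strictly_convex_on :: "'a::real_vector set \<Rightarrow> ('a \<Rightarrow> real) \<Rightarrow> bool" where
  "strictly_convex_on S f \<longleftrightarrow> convex S \<and>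
     (\<forall>x\<in>S. \<forall>y\<in>S. \<forall>u>0. \<forall>v>0. x \<noteq> y \<longrightarrow> u + v = 1 \<longrightarrow>
        f (u *\<^sub>R x + v *\<^sub>R y) < u * f x + v * f y)"

(* Frechet sense, without continuity of the second derivative: f is differentiable on S and its
   derivative f', as a map into the normed space of bounded linear functionals, is again
   differentiable on S. Intended for open S, where derivatives within S are ordinary ones. *)
definition twice_differentiable_on :: "('a::real_normed_vector \<Rightarrow> real) \<Rightarrow> 'a set \<Rightarrow> bool" where
  "twice_differentiable_on f S \<longleftrightarrow>
     (\<exists>f' :: 'a \<Rightarrow> 'a \<Rightarrow>\<^sub>L real.
        (\<forall>x\<in>S. (f has_derivative blinfun_apply (f' x)) (at x within S)) \<and>
        f' differentiable_on S)"

end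

theory Submission
  imports Defs
begin

text \<open>The function \<open>h\<close> is the perspective of the reduced entropy plus \<open>w\<^sub>0 ln w\<^sub>0\<close>. The perspective of a
  convex function is convex, and strictly so along segments whose endpoints have distinct images
  under \<open>w \<mapsto> w / w\<^sub>0\<close>. Along any other segment with distinct endpoints \<open>w\<^sub>0\<close> varies, and there the
  summand \<open>w\<^sub>0 ln w\<^sub>0\<close> is strictly convex.\<close>

section \<open>The realizable cone\<close>

text \<open>Since the zeroth test function is 1 on \<open>V\<close>, the zeroth moment is the
  integral of the density \<open>g\<close> itself. This is positive because \<open>g\<close> is
  nonnegative and not almost everywhere zero.\<close>

lemma realizable_set_fst_pos:
  fixes V :: "'v::euclidean_space set" and m :: "'v \<Rightarrow> real \<times> (real ^ 'k)"
  assumes m0: "\<And>v. v \<in> V \<Longrightarrow> fst (m v) = 1"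
    and w: "w \<in> realizable_set V m"
  shows "0 < fst w"
proof -
  obtain g where g: "\<forall>v\<in>V. 0 \<le> g v" "\<not> (AE v in lebesgue_on V. g v = 0)"
      "integrable (lebesgue_on V) (\<lambda>v. g v *\<^sub>R m v)"
      "w = (\<integral>v. g v *\<^sub>R m v \<partial>lebesgue_on V)"
    using w unfolding realizable_set_def by blast
  \<comment> \<open>The normalization of \<open>m\<close> is known only on \<open>V\<close>. As
    \<open>V\<close> is the space of \<open>lebesgue_on V\<close>, that is enough for the congruence
    rules of integrals.\<close>
  have eq: "fst (g v *\<^sub>R m v) = g v" if "v \<in> space (lebesgue_on V)" for v
    using that m0 by (simp add: space_restrict_space)
  have "integrable (lebesgue_on V) (\<lambda>v. fst (g v *\<^sub>R m v))"
    by (rule integrable_bounded_linear[OF bounded_linear_fst g(3)])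
  then have int: "integrable (lebesgue_on V) g"
    using Bochner_Integration.integrable_cong[of "lebesgue_on V" _ "\<lambda>v. fst (g v *\<^sub>R m v)" g,
        OF refl eq] by blast
  have "fst w = (\<integral>v. fst (g v *\<^sub>R m v) \<partial>lebesgue_on V)"
    unfolding g(4) by (rule integral_bounded_linear[OF bounded_linear_fst g(3), symmetric])
  also have "\<dots> = (\<integral>v. g v \<partial>lebesgue_on V)"
    using eq by (intro Bochner_Integration.integral_cong) auto
  finally have fst_w: "fst w = (\<integral>v. g v \<partial>lebesgue_on V)" .
  have nonneg: "AE v in lebesgue_on V. 0 \<le> g v"
    using g(1) by (intro AE_I2) (simp add: space_restrict_space)
  have "fst w \<noteq> 0"
    using integral_nonneg_eq_0_iff_AE[OF int nonneg] g(2) fst_w by simp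
  moreover have "0 \<le> fst w"
    unfolding fst_w by (rule integral_nonneg_AE[OF nonneg])
  ultimately show ?thesis by simp
qed

lemma realizable_set_scaleR:
  assumes "w \<in> realizable_set V m" "0 < c"
  shows "c *\<^sub>R w \<in> realizable_set V m"
proof -
  obtain g where g: "g \<in> borel_measurable (lebesgue_on V)"
      "\<forall>v\<in>V. 0 \<le> g v" "\<not> (AE v in lebesgue_on V. g v = 0)"
      "integrable (lebesgue_on V) (\<lambda>v. g v *\<^sub>R m v)"
      "w = (\<integral>v. g v *\<^sub>R m v \<partial>lebesgue_on V)"
    using assms(1) unfolding realizable_set_def by blast
  have scale: "(\<lambda>v. (c * g v) *\<^sub>R m v) = (\<lambda>v. c *\<^sub>R (g v *\<^sub>R m v))"
    by simp
  show ?thesis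
    unfolding realizable_set_def mem_Collect_eq
  proof (intro exI[of _ "\<lambda>v. c * g v"] conjI)
    show "(\<lambda>v. c * g v) \<in> borel_measurable (lebesgue_on V)"
      using g(1) by measurable
    show "\<forall>v\<in>V. 0 \<le> c * g v" "\<not> (AE v in lebesgue_on V. c * g v = 0)"
      using g assms(2) by auto
    show "integrable (lebesgue_on V) (\<lambda>v. (c * g v) *\<^sub>R m v)"
      unfolding scale using g(4) by (rule integrable_scaleR_right)
    show "c *\<^sub>R w = (\<integral>v. (c * g v) *\<^sub>R m v \<partial>lebesgue_on V)"
      unfolding scale g(5) by (rule integral_scaleR_right[symmetric])
  qed
qed

lemma realizable_set_add:
  fixes V :: "'v::euclidean_space set"
  assumes "w \<in> realizable_set V m" "w' \<in> realizable_set V m"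
  shows "w + w' \<in> realizable_set V m"
proof -
  obtain g where g: "g \<in> borel_measurable (lebesgue_on V)"
      "\<forall>v\<in>V. 0 \<le> g v" "\<not> (AE v in lebesgue_on V. g v = 0)"
      "integrable (lebesgue_on V) (\<lambda>v. g v *\<^sub>R m v)"
      "w = (\<integral>v. g v *\<^sub>R m v \<partial>lebesgue_on V)"
    using assms(1) unfolding realizable_set_def by blast
  obtain g' where g': "g' \<in> borel_measurable (lebesgue_on V)"
      "\<forall>v\<in>V. 0 \<le> g' v" "\<not> (AE v in lebesgue_on V. g' v = 0)"
      "integrable (lebesgue_on V) (\<lambda>v. g' v *\<^sub>R m v)"
      "w' = (\<integral>v. g' v *\<^sub>R m v \<partial>lebesgue_on V)"
    using assms(2) unfolding realizable_set_def by blast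
  have nonneg: "AE v in lebesgue_on V. 0 \<le> g v \<and> 0 \<le> g' v"
    using g(2) g'(2) by (intro AE_I2) (simp add: space_restrict_space)
  \<comment> \<open>Nonnegative densities cannot cancel: if the sum vanishes almost everywhere, so
    does each summand.\<close>
  have nonzero: "\<not> (AE v in lebesgue_on V. g v + g' v = 0)"
  proof
    assume "AE v in lebesgue_on V. g v + g' v = 0"
    with nonneg have "AE v in lebesgue_on V. g v = 0"
      by eventually_elim linarith
    with g(3) show False by contradiction
  qed
  show ?thesis
    unfolding realizable_set_def mem_Collect_eq
  proof (intro exI[of _ "\<lambda>v. g v + g' v"] conjI)
    show "(\<lambda>v. g v + g' v) \<in> borel_measurable (lebesgue_on V)"
      using g(1) g'(1) by measurable
    show "\<forall>v\<in>V. 0 \<le> g v + g' v"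
      using g(2) g'(2) by simp
    show "\<not> (AE v in lebesgue_on V. g v + g' v = 0)"
      by (fact nonzero)
    show "integrable (lebesgue_on V) (\<lambda>v. (g v + g' v) *\<^sub>R m v)"
      unfolding scaleR_left_distrib using g(4) g'(4) by (rule Bochner_Integration.integrable_add)
    show "w + w' = (\<integral>v. (g v + g' v) *\<^sub>R m v \<partial>lebesgue_on V)"
      unfolding scaleR_left_distrib g(5) g'(5)
      using g(4) g'(4) by (rule Bochner_Integration.integral_add[symmetric])
  qed
qed

lemma convex_realizable_set:
  fixes V :: "'v::euclidean_space set" and m :: "'v \<Rightarrow> real \<times> (real ^ 'k)"
  shows "convex (realizable_set V m)"
proof (rule convexI)
  fix x y and u v :: real
  assume xy: "x \<in> realizable_set V m" "y \<in> realizable_set V m"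
    and uv: "0 \<le> u" "0 \<le> v" "u + v = 1"
  show "u *\<^sub>R x + v *\<^sub>R y \<in> realizable_set V m"
  \<comment> \<open>Scaling preserves realizability only for positive factors; with a zero weight
    the combination is one of the endpoints.\<close>
  proof (cases "u = 0 \<or> v = 0")
    case True
    then show ?thesis using xy uv by auto
  next
    case False
    then show ?thesis
      using xy uv by (intro realizable_set_add realizable_set_scaleR) auto
  qed
qed

lemma realizable_set_normalize:
  fixes w\<^sub>0 :: real
  assumes "(w\<^sub>0, w) \<in> realizable_set V m" "0 < w\<^sub>0"
  shows "w /\<^sub>R w\<^sub>0 \<in> normalized_realizable_set V m"
  using realizable_set_scaleR[OF assms(1), of "inverse w\<^sub>0"] assms(2)
  by (simp add: normalized_realizable_set_def)

text \<open>The normalized set is the preimage of an open set under a continuous embedding. Its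
  openness turns derivatives within it into ordinary ones, ready for the chain rule.\<close>

lemma open_normalized_realizable_set:
  assumes "open (realizable_set V m)"
  shows "open (normalized_realizable_set V m)"
proof -
  have "open ((\<lambda>\<omega>. (1, \<omega>)) -` realizable_set V m)"
    using assms by (intro open_vimage continuous_intros)
  then show ?thesis
    by (simp add: normalized_realizable_set_def vimage_def)
qed

section \<open>Convexity of the perspective\<close>

text \<open>The graph of \<open>x * ln x\<close> lies above its tangent at the mean
  \<open>c\<close>, which is the inequality \<open>ln t \<le> t - 1\<close> at
  \<open>t = c / x\<close>. Averaging over \<open>a\<close> and \<open>b\<close> cancels the linear
  terms.\<close>

lemma mult_ln_convex_comb:
  fixes a b u v :: real
  assumes pos: "0 < a" "0 < b" "0 < u" "0 < v" and uv: "u + v = 1"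
  defines "c \<equiv> u * a + v * b"
  shows "c * ln c \<le> u * (a * ln a) + v * (b * ln b)" (is "?le")
    and "a \<noteq> b \<Longrightarrow> c * ln c < u * (a * ln a) + v * (b * ln b)" (is "_ \<Longrightarrow> ?less")
proof -
  have c: "0 < c" unfolding c_def using pos by (intro add_pos_pos mult_pos_pos)
  have tangent: "x * ln c - x * ln x \<le> c - x" "x \<noteq> c \<Longrightarrow> x * ln c - x * ln x < c - x"
    if x: "0 < x" for x
  proof -
    have eq: "x * ln c - x * ln x = x * ln (c / x)" "x * (c / x - 1) = c - x"
      using x c by (simp_all add: ln_div algebra_simps)
    have ln: "ln (c / x) \<le> c / x - 1"
      using x c by (intro ln_le_minus_one) simp
    show "x * ln c - x * ln x \<le> c - x"
      using mult_left_mono[OF ln, of x] x unfolding eq by simp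
    assume "x \<noteq> c"
    then have "ln (c / x) \<noteq> c / x - 1"
      using ln_eq_minus_one[of "c / x"] x c by auto
    with ln have "ln (c / x) < c / x - 1" by simp
    from mult_strict_left_mono[OF this x] show "x * ln c - x * ln x < c - x"
      unfolding eq .
  qed
  \<comment> \<open>The weighted deviations from the mean cancel.\<close>
  have sum: "u * (c - a) + v * (c - b) = 0"
  proof -
    have "u * (c - a) + v * (c - b) = (u + v) * c - c"
      by (simp add: c_def algebra_simps)
    then show ?thesis using uv by simp
  qed
  have split: "c * ln c = u * (a * ln c) + v * (b * ln c)"
    by (simp add: c_def algebra_simps)
  have b: "v * (b * ln c - b * ln b) \<le> v * (c - b)"
    using tangent(1)[OF pos(2)] pos by (intro mult_left_mono) auto
  have "u * (a * ln c - a * ln a) \<le> u * (c - a)"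
    using tangent(1)[OF pos(1)] pos by (intro mult_left_mono) auto
  with b sum split show ?le by (simp add: right_diff_distrib)
  assume "a \<noteq> b"
  \<comment> \<open>One strict tangent inequality suffices: \<open>a\<close> differs from the mean
    as soon as it differs from \<open>b\<close>.\<close>
  have "c - a = v * (b - a)"
    using uv by (simp add: c_def algebra_simps flip: distrib_right eq_diff_eq)
  with \<open>a \<noteq> b\<close> pos have "a \<noteq> c" by auto
  from tangent(2)[OF pos(1) this] have "u * (a * ln c - a * ln a) < u * (c - a)"
    using pos by (intro mult_strict_left_mono) auto
  with b sum split show ?less by (simp add: right_diff_distrib)
qed

text \<open>Normalizing a mixture gives a mixture of the normalized points, but with weights
  proportional to the masses \<open>u * a\<close> and \<open>v * b\<close> instead of
  \<open>u\<close> and \<open>v\<close>.\<close>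

lemma perspective_convex_comb:
  fixes w z :: "'a::real_vector" and a b u v :: real
  assumes "0 < a" "0 < b" "0 < u" "0 < v"
  defines "c \<equiv> u * a + v * b"
  shows "0 < c" "0 < u * a / c" "0 < v * b / c" "u * a / c + v * b / c = 1"
    and "(u *\<^sub>R w + v *\<^sub>R z) /\<^sub>R c = (u * a / c) *\<^sub>R (w /\<^sub>R a) + (v * b / c) *\<^sub>R (z /\<^sub>R b)"
proof -
  show c: "0 < c" unfolding c_def using assms by (intro add_pos_pos mult_pos_pos)
  show "0 < u * a / c" "0 < v * b / c"
    using assms c by simp_all
  show "u * a / c + v * b / c = 1"
    using c by (simp add: c_def flip: add_divide_distrib)
  show "(u *\<^sub>R w + v *\<^sub>R z) /\<^sub>R c = (u * a / c) *\<^sub>R (w /\<^sub>R a) + (v * b / c) *\<^sub>R (z /\<^sub>R b)"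
  proof -
    have "u * a / c * inverse a = inverse c * u" "v * b / c * inverse b = inverse c * v"
      using assms(1,2) by (simp_all add: field_simps)
    then show ?thesis by (simp only: scaleR_right_distrib scaleR_scaleR)
  qed
qed

text \<open>Convexity of \<open>f\<close> is applied with the mass weights; multiplying by the total
  mass \<open>c\<close> then clears their denominators.\<close>

lemma convex_on_perspective_comb:
  fixes f :: "'a::real_vector \<Rightarrow> real" and a b u v :: real
  assumes f: "convex_on N f" and N: "w /\<^sub>R a \<in> N" "z /\<^sub>R b \<in> N"
    and pos: "0 < a" "0 < b" "0 < u" "0 < v"
  defines "c \<equiv> u * a + v * b"
  shows "c * f ((u *\<^sub>R w + v *\<^sub>R z) /\<^sub>R c) \<le> u * (a * f (w /\<^sub>R a)) + v * (b * f (z /\<^sub>R b))"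
proof -
  note comb = perspective_convex_comb[OF pos, folded c_def]
  have "f ((u *\<^sub>R w + v *\<^sub>R z) /\<^sub>R c) \<le> u * a / c * f (w /\<^sub>R a) + v * b / c * f (z /\<^sub>R b)"
    unfolding comb(5) using f N comb(2-4) unfolding convex_on_def by (meson less_imp_le)
  from mult_left_mono[OF this, of c] comb(1) show ?thesis
    by (simp add: distrib_left mult.assoc)
qed

lemma convex_on_perspective_entropy:
  fixes f :: "'a::real_vector \<Rightarrow> real"
  assumes f: "convex_on N f" and K: "convex K"
    and pos: "\<And>a w. (a, w) \<in> K \<Longrightarrow> 0 < a"
    and N: "\<And>a w. (a, w) \<in> K \<Longrightarrow> w /\<^sub>R a \<in> N"
    and h: "\<And>a w. (a, w) \<in> K \<Longrightarrow> h (a, w) = a * f (w /\<^sub>R a) + a * ln a"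
  shows "convex_on K h"
proof (rule convex_onI)
  fix t :: real and x y
  assume t: "0 < t" "t < 1" and x: "x \<in> K" and y: "y \<in> K"
  obtain a w b z where xy: "x = (a, w)" "y = (b, z)" by (metis surj_pair)
  define u where "u = 1 - t"
  have u: "0 < u" "u + t = 1" using t by (simp_all add: u_def)
  define c where "c = u * a + t * b"
  have ab: "0 < a" "0 < b" using pos x y xy by auto
  have in_K: "(c, u *\<^sub>R w + t *\<^sub>R z) \<in> K"
    using convexD[OF K x y, of u t] u t by (simp add: xy c_def)
  have "c * f ((u *\<^sub>R w + t *\<^sub>R z) /\<^sub>R c) \<le> u * (a * f (w /\<^sub>R a)) + t * (b * f (z /\<^sub>R b))"
    unfolding c_def using N x y xy
    by (intro convex_on_perspective_comb[OF f _ _ ab u(1) t(1)]) auto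
  moreover have "c * ln c \<le> u * (a * ln a) + t * (b * ln b)"
    unfolding c_def by (rule mult_ln_convex_comb(1)[OF ab u(1) t(1) u(2)])
  ultimately have "h (c, u *\<^sub>R w + t *\<^sub>R z) \<le> u * h x + t * h y"
    using h[OF in_K] h[of a w] h[of b z] x y xy by (simp add: distrib_left)
  then show "h ((1 - t) *\<^sub>R x + t *\<^sub>R y) \<le> (1 - t) * h x + t * h y"
    by (simp add: xy c_def u_def)
qed (fact K)

lemma strictly_convex_on_imp_convex_on:
  assumes "strictly_convex_on S f"
  shows "convex_on S f"
proof (rule convex_onI)
  show "convex S" using assms by (simp add: strictly_convex_on_def)
  fix t :: real and x y
  assume "0 < t" "t < 1" "x \<in> S" "y \<in> S"
  then show "f ((1 - t) *\<^sub>R x + t *\<^sub>R y) \<le> (1 - t) * f x + t * f y"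
    using assms unfolding strictly_convex_on_def
    \<comment> \<open>Strict convexity says nothing about equal endpoints, where both sides reduce
      to \<open>f x\<close>.\<close>
    by (cases "x = y") (auto simp flip: scaleR_left_distrib distrib_right intro!: less_imp_le)
qed

lemma strictly_convex_on_perspective_entropy:
  fixes f :: "'a::real_vector \<Rightarrow> real"
  assumes f: "strictly_convex_on N f" and K: "convex K"
    and pos: "\<And>a w. (a, w) \<in> K \<Longrightarrow> 0 < a"
    and N: "\<And>a w. (a, w) \<in> K \<Longrightarrow> w /\<^sub>R a \<in> N"
    and h: "\<And>a w. (a, w) \<in> K \<Longrightarrow> h (a, w) = a * f (w /\<^sub>R a) + a * ln a"
  shows "strictly_convex_on K h"
  unfolding strictly_convex_on_def
proof (intro conjI ballI allI impI)
  fix u t :: real and x y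
  assume u: "0 < u" and t: "0 < t" and ut: "u + t = 1"
    and x: "x \<in> K" and y: "y \<in> K" and ne: "x \<noteq> y"
  obtain a w b z where xy: "x = (a, w)" "y = (b, z)" by (metis surj_pair)
  define c where "c = u * a + t * b"
  have ab: "0 < a" "0 < b" using pos x y xy by auto
  note comb = perspective_convex_comb[OF ab u t, folded c_def]
  have in_K: "(c, u *\<^sub>R w + t *\<^sub>R z) \<in> K"
    using convexD[OF K x y, of u t] u t ut by (simp add: xy c_def)
  have in_N: "w /\<^sub>R a \<in> N" "z /\<^sub>R b \<in> N" using N x y xy by auto
  have ln: "c * ln c \<le> u * (a * ln a) + t * (b * ln b)"
    unfolding c_def by (rule mult_ln_convex_comb(1)[OF ab u t ut])
  have persp: "c * f ((u *\<^sub>R w + t *\<^sub>R z) /\<^sub>R c) \<le> u * (a * f (w /\<^sub>R a)) + t * (b * f (z /\<^sub>R b))"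
    unfolding c_def
    by (rule convex_on_perspective_comb[OF strictly_convex_on_imp_convex_on[OF f] in_N ab u t])
  \<comment> \<open>The split is on the masses. If they differ, the logarithmic term is strict and
    the perspective weakly convex; if they agree, distinct endpoints have distinct normalizations
    and the roles are exchanged.\<close>
  have "c * f ((u *\<^sub>R w + t *\<^sub>R z) /\<^sub>R c) + c * ln c
      < u * (a * f (w /\<^sub>R a)) + t * (b * f (z /\<^sub>R b)) + (u * (a * ln a) + t * (b * ln b))"
  proof (cases "a = b")
    case False
    have "c * ln c < u * (a * ln a) + t * (b * ln b)"
      unfolding c_def by (rule mult_ln_convex_comb(2)[OF ab u t ut False])
    with persp show ?thesis by (rule add_le_less_mono)
  next
    case True
    with ne xy ab have "w /\<^sub>R a \<noteq> z /\<^sub>R b" by simp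
    then have "f ((u *\<^sub>R w + t *\<^sub>R z) /\<^sub>R c) < u * a / c * f (w /\<^sub>R a) + t * b / c * f (z /\<^sub>R b)"
      unfolding comb(5) using f comb(2-4) in_N unfolding strictly_convex_on_def by blast
    from mult_strict_left_mono[OF this comb(1)] comb(1)
    have "c * f ((u *\<^sub>R w + t *\<^sub>R z) /\<^sub>R c) < u * (a * f (w /\<^sub>R a)) + t * (b * f (z /\<^sub>R b))"
      by (simp add: distrib_left mult.assoc)
    then show ?thesis using ln by (rule add_less_le_mono)
  qed
  then have "h (c, u *\<^sub>R w + t *\<^sub>R z) < u * h x + t * h y"
    using h[OF in_K] h[of a w] h[of b z] x y xy by (simp add: distrib_left)
  then show "h (u *\<^sub>R x + t *\<^sub>R y) < u * h x + t * h y"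
    by (simp add: xy c_def)
qed (fact K)

section \<open>Differentiability of the perspective\<close>

text \<open>The chain and product rules give an explicit derivative \<open>G\<close>, assembled by
  sums, products and bounded bilinear maps from differentiable pieces, so \<open>G\<close> is
  differentiable as an operator-valued map.\<close>

lemma twice_differentiable_on_perspective_entropy:
  fixes f :: "'a::real_normed_vector \<Rightarrow> real"
  assumes f: "twice_differentiable_on f N" and "open N" "open K"
    and pos: "\<And>a w. (a, w) \<in> K \<Longrightarrow> 0 < a"
    and N: "\<And>a w. (a, w) \<in> K \<Longrightarrow> w /\<^sub>R a \<in> N"
    and h: "\<And>a w. (a, w) \<in> K \<Longrightarrow> h (a, w) = a * f (w /\<^sub>R a) + a * ln a"
  shows "twice_differentiable_on h K"
proof -
  obtain F where F: "\<And>x. x \<in> N \<Longrightarrow> (f has_derivative blinfun_apply (F x)) (at x)"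
      and F_diff: "\<And>x. x \<in> N \<Longrightarrow> F differentiable (at x)"
    using f \<open>open N\<close> unfolding twice_differentiable_on_def differentiable_on_def
    by (metis at_within_open)
  define p :: "real \<times> 'a \<Rightarrow> 'a" where "p x = snd x /\<^sub>R fst x" for x
  have fst_pos: "0 < fst x" and p_N: "p x \<in> N"
    and h_eq: "h x = fst x * f (p x) + fst x * ln (fst x)" if "x \<in> K" for x
    using that pos[of "fst x" "snd x"] N[of "fst x" "snd x"] h[of "fst x" "snd x"]
    by (simp_all add: p_def)
  \<comment> \<open>This is the quotient rule for \<open>snd x /\<^sub>R fst x\<close>, rewritten in
    terms of \<open>p x\<close>.\<close>
  have p_deriv: "(p has_derivative (\<lambda>d. (snd d - fst d *\<^sub>R p x) /\<^sub>R fst x)) (at x)"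
    if "x \<in> K" for x
    unfolding p_def using fst_pos[OF that]
    by (auto intro!: derivative_eq_intros simp: algebra_simps)
  \<comment> \<open>In \<open>fst x * f (p x)\<close> the outer factor cancels the
    \<open>1 / fst x\<close> from the derivative of \<open>p\<close>. What remains is sorted by the
    increments of the two components; \<open>ln (fst x) + 1\<close> comes from the logarithmic
    term.\<close>
  define G where "G x = (f (p x) - F (p x) (p x) + ln (fst x) + 1) *\<^sub>R fst_blinfun
    + (F (p x) o\<^sub>L snd_blinfun)" for x :: "real \<times> 'a"
  have "(h has_derivative blinfun_apply (G x)) (at x)" if x: "x \<in> K" for x
  proof -
    have fp: "((\<lambda>x. f (p x)) has_derivative (\<lambda>d. F (p x) ((snd d - fst d *\<^sub>R p x) /\<^sub>R fst x))) (at x)"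
      using has_derivative_compose[OF p_deriv[OF x] F[OF p_N[OF x]]] .
    have "((\<lambda>x. fst x * f (p x) + fst x * ln (fst x)) has_derivative blinfun_apply (G x)) (at x)"
      using fst_pos[OF x]
      by (auto intro!: derivative_eq_intros fp
          simp: G_def blinfun.bilinear_simps fun_eq_iff field_simps)
    then show ?thesis
      \<comment> \<open>The formula for \<open>h\<close> holds only on \<open>K\<close>, whose
        openness makes it valid near \<open>x\<close>.\<close>
      by (rule has_derivative_transform_within_open[OF _ \<open>open K\<close> x]) (simp add: h_eq)
  qed
  moreover have "G differentiable (at x)" if x: "x \<in> K" for x
  proof -
    have p: "p differentiable (at x)"
      using p_deriv[OF x] by (rule differentiableI)
    have fp: "(\<lambda>x. f (p x)) differentiable (at x)"
      using has_derivative_compose[OF p_deriv[OF x] F[OF p_N[OF x]]] by (rule differentiableI)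
    have Fp: "(\<lambda>x. F (p x)) differentiable (at x)"
      using F_diff[OF p_N[OF x]] p_deriv[OF x] unfolding differentiable_def
      by (blast intro: has_derivative_compose)
    \<comment> \<open>Evaluating an operator at a vector is bounded bilinear in the pair, so the
      product rule applies although both arguments vary.\<close>
    have Fpp: "(\<lambda>x. F (p x) (p x)) differentiable (at x)"
      using Fp p unfolding differentiable_def[of _ "at x"]
      by (elim exE) (rule exI, rule bounded_bilinear.FDERIV[OF bounded_bilinear_blinfun_apply])
    \<comment> \<open>The same product rule for composition, now with a constant second
      factor.\<close>
    have Fs: "(\<lambda>x. F (p x) o\<^sub>L snd_blinfun) differentiable (at x)"
      using Fp unfolding differentiable_def[of _ "at x"]
      by (elim exE) (rule exI, rule bounded_bilinear.FDERIV[OF bounded_bilinear_blinfun_compose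
            _ has_derivative_const])
    have ln: "(\<lambda>x::real \<times> 'a. ln (fst x)) differentiable (at x)"
      unfolding differentiable_def using fst_pos[OF x]
      by (auto intro!: exI derivative_eq_intros)
    show ?thesis
      unfolding G_def using fp Fpp Fs ln
      by (intro differentiable_add differentiable_diff differentiable_scaleR differentiable_const)
  qed
  ultimately show ?thesis
    unfolding twice_differentiable_on_def differentiable_on_def
    by (metis at_within_open[OF _ \<open>open K\<close>])
qed

theorem theorem3p2:
  fixes V :: "(real ^ 'd) set"
    and m :: "real ^ 'd \<Rightarrow> real \<times> (real ^ 'k)"
    and h_red :: "real ^ 'k \<Rightarrow> real"
    and h :: "real \<times> (real ^ 'k) \<Rightarrow> real"
  assumes "V \<in> sets lebesgue"
    and "\<And>v. v \<in> V \<Longrightarrow> fst (m v) = 1"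
    and "linearly_independent_on V m"
    and "open (realizable_set V m)"
    and "\<And>w\<^sub>0 w. (w\<^sub>0, w) \<in> realizable_set V m \<Longrightarrow>
           h (w\<^sub>0, w) = w\<^sub>0 * h_red (w /\<^sub>R w\<^sub>0) + w\<^sub>0 * ln w\<^sub>0"
  shows "(convex_on (normalized_realizable_set V m) h_red \<and>
          twice_differentiable_on h_red (normalized_realizable_set V m) \<longrightarrow>
          convex_on (realizable_set V m) h \<and>
          twice_differentiable_on h (realizable_set V m)) \<and>
         (strictly_convex_on (normalized_realizable_set V m) h_red \<and>
          twice_differentiable_on h_red (normalized_realizable_set V m) \<longrightarrow>
          strictly_convex_on (realizable_set V m) h \<and>
          twice_differentiable_on h (realizable_set V m))"
proof -
  let ?K = "realizable_set V m" and ?N = "normalized_realizable_set V m"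
  have pos: "0 < a" if "(a, w) \<in> ?K" for a w
    using realizable_set_fst_pos[OF assms(2) that] by simp
  have N: "w /\<^sub>R a \<in> ?N" if "(a, w) \<in> ?K" for a w
    using realizable_set_normalize[OF that pos[OF that]] .
  \<comment> \<open>Smoothness is obtained independently of convexity and serves both
    implications.\<close>
  have "twice_differentiable_on h ?K" if "twice_differentiable_on h_red ?N"
    by (rule twice_differentiable_on_perspective_entropy[OF that
          open_normalized_realizable_set[OF assms(4)] assms(4)]) (fact pos N assms(5))+
  moreover have "convex_on ?K h" if "convex_on ?N h_red"
    by (rule convex_on_perspective_entropy[OF that convex_realizable_set]) (fact pos N assms(5))+
  moreover have "strictly_convex_on ?K h" if "strictly_convex_on ?N h_red"
    by (rule strictly_convex_on_perspective_entropy[OF that convex_realizable_set])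
      (fact pos N assms(5))+
  ultimately show ?thesis by blast
qed

end
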